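(* Let $g\ge2$ and let $\mathcal G_g$ be the finite-dimensional real vector space of block data $(A_{01},A_{12},D,E,F,c)$ described in the context (the Gram-block data of a mixed-degenerate ladder with eigenspace dimensions $(1,g,1)$). Let $\mathcal P$ be a connected finite-dimensional real-analytic manifold (of physical parameters) and let $\Xi:\mathcal P\to\mathcal G_g$ be a real-analytic map whose values are Gram-block data, i.e. the associated block matrix $\mathcal G$ is positive semidefinite. Let $\mathcal S\subseteq\mathcal P$ be the set of parameters at which physical joint saturation occurs, and assume that for every point of $\mathcal S$ the corresponding data $(A_{01},A_{12},D,E,F,c)=\Xi(\cdot)$ have $A_{01}$ and $A_{12}$ nonzero and of rank one and satisfy $$\operatorname{rank}[A_{01}\ D]\le1,\quad \operatorname{rank}[A_{12}\ E]\le1,\quad \operatorname{rank}[A_{01}\ F]\le1,\quad \operatorname{rank}[A_{12}\ F^\dagger]\le1 .$$ Let $h_1,\dots,h_m$ be the real and imaginary parts of all $2\times2$ minors of the four augmented matrices $[A_{01}\ D]$, $[A_{12}\ E]$, $[A_{01}\ F]$, $[A_{12}\ F^\dagger]$, regarded as real polynomials on $\mathcal G_g$. If at least one pullback $h_j\circ\Xi$ is not identically zero on $\mathcal P$, then the joint-saturation locus $\mathcal S$ is contained in a proper real-analytic subset of $\mathcal P$, and it has measure zero with respect to every smooth positive volume measure on $\mathcal P$.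
   Context: The block data consist of Hermitian matrices $A_{01},A_{12}\in M_g(\mathbb C)$, vectors $D,E\in\mathbb C^g$, a matrix $F\in M_g(\mathbb C)$ and a real number $c$, assembled into the $(2g+1)\times(2g+1)$ Hermitian matrix $$\mathcal G=\begin{pmatrix} A_{01} & F & D \\ {F^\dagger} & A_{12} & E \\ {D^\dagger} & E^\dagger & c \end{pmatrix},$$ which is required to be positive semidefinite for Gram-block data. "Physical joint saturation" enters only through the set $\mathcal S$ and the assumption made on it; $\mathcal S$ may be treated as an arbitrary subset of $\mathcal P$ satisfying that assumption. $[X\ Y]$ denotes horizontal concatenation. *)

theory Defs
  imports "HOL-Analysis.Analysis"
begin

section \<open>Block data\<close>

text \<open>The tuple \<open>(A01, A12, D, E, F, c)\<close>. The type itself imposes no Hermiticity; the real vector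
  space of block data is the real subspace \<open>block_space\<close> of this Euclidean space.\<close>

type_synonym 'g block_data =
  "(complex^'g^'g) \<times> (complex^'g^'g) \<times> (complex^'g) \<times> (complex^'g) \<times> (complex^'g^'g) \<times> real"

definition conj_transpose :: "complex^'n^'m \<Rightarrow> complex^'m^'n" where
  "conj_transpose M = (\<chi> i j. cnj (M $ j $ i))"

definition hermitian :: "complex^'n^'n \<Rightarrow> bool" where
  "hermitian M \<longleftrightarrow> conj_transpose M = M"

definition pos_semidef :: "complex^'n^'n \<Rightarrow> bool" where
  "pos_semidef M \<longleftrightarrow> hermitian M \<and>
     (\<forall>v. 0 \<le> Re (\<Sum>i\<in>UNIV. \<Sum>j\<in>UNIV. cnj (v $ i) * M $ i $ j * v $ j))"

definition hconcat :: "'a^'k^'m \<Rightarrow> 'a^'l^'m \<Rightarrow> 'a^('k + 'l)^'m" where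
  "hconcat X Y = (\<chi> i j. case j of Inl k \<Rightarrow> X $ i $ k | Inr l \<Rightarrow> Y $ i $ l)"

definition vconcat :: "'a^'n^'k \<Rightarrow> 'a^'n^'l \<Rightarrow> 'a^'n^('k + 'l)" where
  "vconcat X Y = (\<chi> i j. case i of Inl k \<Rightarrow> X $ k $ j | Inr l \<Rightarrow> Y $ l $ j)"

definition block_space :: "'g::finite block_data set" where
  "block_space = {(A01, A12, D, E, F, c). hermitian A01 \<and> hermitian A12}"

lemma subspace_block_space: "subspace (block_space :: 'g::finite block_data set)"
  by (auto simp: subspace_def block_space_def hermitian_def conj_transpose_def zero_prod_def vec_eq_iff)

fun block_matrix :: "'g::finite block_data \<Rightarrow> complex^('g + ('g + 1))^('g + ('g + 1))" where
  "block_matrix (A01, A12, D, E, F, c) =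
     vconcat (hconcat A01 (hconcat F (columnvector D)))
    (vconcat (hconcat (conj_transpose F) (hconcat A12 (columnvector E)))
             (hconcat (conj_transpose (columnvector D))
               (hconcat (conj_transpose (columnvector E)) (mat (complex_of_real c)))))"

definition gram_block_data :: "'g::finite block_data \<Rightarrow> bool" where
  "gram_block_data X \<longleftrightarrow> X \<in> block_space \<and> pos_semidef (block_matrix X)"

fun aug_01_D :: "'g::finite block_data \<Rightarrow> complex^('g + 1)^'g" where
  "aug_01_D (A01, A12, D, E, F, c) = hconcat A01 (columnvector D)"

fun aug_12_E :: "'g::finite block_data \<Rightarrow> complex^('g + 1)^'g" where
  "aug_12_E (A01, A12, D, E, F, c) = hconcat A12 (columnvector E)"

fun aug_01_F :: "'g::finite block_data \<Rightarrow> complex^('g + 'g)^'g" where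
  "aug_01_F (A01, A12, D, E, F, c) = hconcat A01 F"

fun aug_12_F :: "'g::finite block_data \<Rightarrow> complex^('g + 'g)^'g" where
  "aug_12_F (A01, A12, D, E, F, c) = hconcat A12 (conj_transpose F)"

fun rank_one_conditions :: "'g::finite block_data \<Rightarrow> bool" where
  "rank_one_conditions (A01, A12, D, E, F, c) \<longleftrightarrow>
     A01 \<noteq> 0 \<and> rank A01 = 1 \<and> A12 \<noteq> 0 \<and> rank A12 = 1 \<and>
     rank (hconcat A01 (columnvector D) :: complex^('g + 1)^'g) \<le> 1 \<and>
     rank (hconcat A12 (columnvector E) :: complex^('g + 1)^'g) \<le> 1 \<and>
     rank (hconcat A01 F) \<le> 1 \<and>
     rank (hconcat A12 (conj_transpose F)) \<le> 1"

text \<open>Rows and columns of a minor are selected by injections from the two-element type, so every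
  minor is listed together with its negative (the rows or columns being swapped).\<close>

definition minor2 :: "complex^'n^'m \<Rightarrow> (2 \<Rightarrow> 'm) \<Rightarrow> (2 \<Rightarrow> 'n) \<Rightarrow> complex" where
  "minor2 M r s = det (\<chi> a b. M $ r a $ s b)"

definition re_im_minors ::
    "('g::finite block_data \<Rightarrow> complex^'n^'m) \<Rightarrow> ('g block_data \<Rightarrow> real) set" where
  "re_im_minors M =
     {(\<lambda>X. Re (minor2 (M X) r s)) | r s. inj r \<and> inj s} \<union>
     {(\<lambda>X. Im (minor2 (M X) r s)) | r s. inj r \<and> inj s}"

definition minor_functions :: "('g::finite block_data \<Rightarrow> real) set" where
  "minor_functions =
     re_im_minors aug_01_D \<union> re_im_minors aug_12_E \<union>
     re_im_minors aug_01_F \<union> re_im_minors aug_12_F"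


section \<open>Analytic and smooth functions on open subsets of \<open>\<real>\<^sup>n\<close>\<close>

text \<open>Here \<open>\<real>\<^sup>n\<close> is the set of extensional functions \<open>{..<n} \<rightarrow>\<^sub>E UNIV\<close>, that is, the underlying set
  of the topology \<open>powertop_real {..<n}\<close> and of the measure \<open>PiM {..<n} (\<lambda>_. lborel)\<close>. The case
  \<open>n = 0\<close> is included. The domain \<open>W\<close> below is always meant to be open.\<close>

definition real_analytic_on ::
    "nat \<Rightarrow> (nat \<Rightarrow> real) set \<Rightarrow> ((nat \<Rightarrow> real) \<Rightarrow> 'b::real_normed_vector) \<Rightarrow> bool" where
  "real_analytic_on n W f \<longleftrightarrow>
     (\<forall>x\<in>W. \<exists>r>0. \<exists>a :: (nat \<Rightarrow> nat) \<Rightarrow> 'b. \<forall>y\<in>W. (\<forall>i<n. \<bar>y i - x i\<bar> < r) \<longrightarrow>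
        ((\<lambda>\<alpha>. (\<Prod>i<n. (y i - x i) ^ \<alpha> i) *\<^sub>R a \<alpha>) has_sum f y) {\<alpha>. \<forall>i\<ge>n. \<alpha> i = 0})"

text \<open>\<open>C_k_on k\<close> is \<open>C\<^sup>k\<close> in terms of iterated continuous partial derivatives.\<close>

primrec C_k_on :: "nat \<Rightarrow> nat \<Rightarrow> (nat \<Rightarrow> real) set \<Rightarrow> ((nat \<Rightarrow> real) \<Rightarrow> real) \<Rightarrow> bool" where
  "C_k_on 0 n W f \<longleftrightarrow> continuous_map (subtopology (powertop_real {..<n}) W) euclideanreal f"
| "C_k_on (Suc k) n W f \<longleftrightarrow>
     continuous_map (subtopology (powertop_real {..<n}) W) euclideanreal f \<and>
     (\<forall>i<n. \<exists>g. C_k_on k n W g \<and>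
        (\<forall>x\<in>W. ((\<lambda>t. f (x(i := t))) has_real_derivative g x) (at (x i))))"

definition smooth_on :: "nat \<Rightarrow> (nat \<Rightarrow> real) set \<Rightarrow> ((nat \<Rightarrow> real) \<Rightarrow> real) \<Rightarrow> bool" where
  "smooth_on n W f \<longleftrightarrow> (\<forall>k. C_k_on k n W f)"


section \<open>Real-analytic manifolds\<close>

text \<open>The manifold is a whole (Hausdorff, second countable) type \<open>'p\<close> with an analytic atlas \<open>\<A>\<close> of
  charts \<open>(U, \<phi>)\<close>. Only the values of \<open>\<phi>\<close> on \<open>U\<close> matter.\<close>

type_synonym 'p chart = "'p set \<times> ('p \<Rightarrow> nat \<Rightarrow> real)"

definition is_chart :: "nat \<Rightarrow> 'p::topological_space chart \<Rightarrow> bool" where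
  "is_chart n = (\<lambda>(U, \<phi>). open U \<and> openin (powertop_real {..<n}) (\<phi> ` U) \<and>
     homeomorphic_map (top_of_set U) (subtopology (powertop_real {..<n}) (\<phi> ` U)) \<phi>)"

definition analytic_atlas ::
    "nat \<Rightarrow> 'p::{t2_space, second_countable_topology} chart set \<Rightarrow> bool" where
  "analytic_atlas n \<A> \<longleftrightarrow>
     (\<forall>C\<in>\<A>. is_chart n C) \<and> (\<Union>(U, \<phi>)\<in>\<A>. U) = UNIV \<and>
     (\<forall>(U, \<phi>)\<in>\<A>. \<forall>(V, \<psi>)\<in>\<A>. \<forall>i<n.
        real_analytic_on n (\<phi> ` (U \<inter> V)) (\<lambda>x. \<psi> (inv_into U \<phi> x) i))"

definition analytic_map_on ::
    "nat \<Rightarrow> 'p chart set \<Rightarrow> 'p set \<Rightarrow> ('p \<Rightarrow> 'b::real_normed_vector) \<Rightarrow> bool" where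
  "analytic_map_on n \<A> W f \<longleftrightarrow>
     (\<forall>(U, \<phi>)\<in>\<A>. real_analytic_on n (\<phi> ` (U \<inter> W)) (\<lambda>x. f (inv_into U \<phi> x)))"

text \<open>Quantifying over all points of the manifold, not only those of \<open>Z\<close>, forces \<open>Z\<close> to be closed.\<close>

definition analytic_subset :: "nat \<Rightarrow> 'p::topological_space chart set \<Rightarrow> 'p set \<Rightarrow> bool" where
  "analytic_subset n \<A> Z \<longleftrightarrow>
     (\<forall>p. \<exists>W H. open W \<and> p \<in> W \<and> finite H \<and>
        (\<forall>f\<in>H. analytic_map_on n \<A> W (f :: 'p \<Rightarrow> real)) \<and>
        Z \<inter> W = {q \<in> W. \<forall>f\<in>H. f q = 0})"

text \<open>A smooth positive volume measure is a Borel measure that in every chart has a smooth positive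
  density with respect to Lebesgue measure.\<close>

definition smooth_volume_measure ::
    "nat \<Rightarrow> 'p::topological_space chart set \<Rightarrow> 'p measure \<Rightarrow> bool" where
  "smooth_volume_measure n \<A> \<mu> \<longleftrightarrow>
     sets \<mu> = sets borel \<and>
     (\<forall>(U, \<phi>)\<in>\<A>. \<exists>\<rho>. smooth_on n (\<phi> ` U) \<rho> \<and> (\<forall>x\<in>\<phi> ` U. \<rho> x > 0) \<and>
        (\<forall>B\<in>sets borel. B \<subseteq> U \<longrightarrow>
           emeasure \<mu> B =
             (\<integral>\<^sup>+x. ennreal (\<rho> x) * indicator (\<phi> ` B) x \<partial>PiM {..<n} (\<lambda>_. lborel))))"

end

theory Submission
  imports Defs "HOL-Complex_Analysis.Conformal_Mappings"
begin

text \<open>Let \<open>f = h \<circ> \<Xi>\<close> for a minor \<open>h\<close> whose pullback is not identically zero. On \<open>S\<close> the rank conditions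
  make all minors vanish, so \<open>S\<close> lies in the zero set of the real-analytic function \<open>f\<close>. The sum of a power
  series on a box of \<open>\<real>\<^sup>n\<close> either vanishes identically or has a Lebesgue null set of zeros. This also
  yields the identity theorem without restricting to lines: if \<open>f\<close> vanishes on a nonempty open subset of
  a coordinate box, its zeros there are not null, so \<open>f\<close> vanishes on the whole box. Hence the interior
  of the zero set is closed, thus empty by connectedness, and countably many boxes on which the zeros
  of \<open>f\<close> are null cover the manifold.\<close>

section \<open>Power series in several real variables\<close>

definition multi_indices :: "nat \<Rightarrow> (nat \<Rightarrow> nat) set" where
  "multi_indices n = {\<alpha>. \<forall>i\<ge>n. \<alpha> i = 0}"

text \<open>The neighbourhoods in \<open>real_analytic_on\<close> are balls of the maximum norm. Cut
  down to extensional functions they are products of intervals, so they are measurable and open in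
  the product structures.\<close>

definition open_box :: "nat \<Rightarrow> (nat \<Rightarrow> real) \<Rightarrow> real \<Rightarrow> (nat \<Rightarrow> real) set" where
  "open_box n x r = (\<Pi>\<^sub>E i\<in>{..<n}. {x i - r<..<x i + r})"

lemma open_box_iff:
  "y \<in> open_box n x r \<longleftrightarrow> y \<in> extensional {..<n} \<and> (\<forall>i<n. \<bar>y i - x i\<bar> < r)"
  by (force simp: open_box_def PiE_iff abs_less_iff)

text \<open>Splits off the exponent of the last variable, for the induction on the
  dimension.\<close>

lemma bij_betw_multi_indices_Suc:
  "bij_betw (\<lambda>(k, \<alpha>). \<alpha>(n := k)) (UNIV \<times> multi_indices n) (multi_indices (Suc n))"
proof (rule bij_betwI[where g = "\<lambda>\<alpha>. (\<alpha> n, \<alpha>(n := 0))"])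
  show "(\<lambda>(k, \<alpha>). \<alpha>(n := k)) \<in> UNIV \<times> multi_indices n \<rightarrow> multi_indices (Suc n)"
    by (auto simp: multi_indices_def)
  show "(\<lambda>\<alpha>. (\<alpha> n, \<alpha>(n := 0))) \<in> multi_indices (Suc n) \<rightarrow> UNIV \<times> multi_indices n"
    by (auto simp: multi_indices_def)
qed (auto simp: multi_indices_def fun_eq_iff)

text \<open>The cubes of exponents at most \<open>N\<close> are finite and exhaust the index set.
  This turns the limit along the net of finite subsets into the limit of a sequence, through which
  measurability passes.\<close>

lemma has_sum_multi_indices_LIMSEQ:
  assumes "(f has_sum S) (multi_indices n)"
  shows "(\<lambda>N. \<Sum>\<alpha>\<in>{\<alpha> \<in> multi_indices n. \<forall>i<n. \<alpha> i \<le> N}. f \<alpha>) \<longlonglongrightarrow> S"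
proof -
  let ?A = "\<lambda>N. {\<alpha> \<in> multi_indices n. \<forall>i<n. \<alpha> i \<le> N}"
  have fin: "finite (?A N)" for N
    by (rule finite_subset[OF _ finite_set_of_finite_funs[of "{..<n}" "{..N}" 0]])
      (auto simp: multi_indices_def)
  have "filterlim ?A (finite_subsets_at_top (multi_indices n)) sequentially"
    unfolding filterlim_finite_subsets_at_top
  proof (intro allI impI)
    fix X assume X: "finite X \<and> X \<subseteq> multi_indices n"
    \<comment> \<open>A crude common bound: the sum of all exponents occurring in \<open>X\<close>
      dominates each of them.\<close>
    define N where "N = (\<Sum>\<alpha>\<in>X. \<Sum>i<n. \<alpha> i)"
    have "\<alpha> i \<le> N" if "\<alpha> \<in> X" "i < n" for \<alpha> i
    proof -
      have "\<alpha> i \<le> (\<Sum>i<n. \<alpha> i)"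
        using that by (intro member_le_sum) auto
      also have "\<dots> \<le> N"
        unfolding N_def using that X by (intro member_le_sum[of \<alpha> X "\<lambda>\<alpha>. \<Sum>i<n. \<alpha> i"]) auto
      finally show ?thesis .
    qed
    then have "X \<subseteq> ?A M" if "M \<ge> N" for M
      using X that by (blast intro: order.trans)
    then have "finite (?A M) \<and> X \<subseteq> ?A M \<and> ?A M \<subseteq> multi_indices n" if "M \<ge> N" for M
      using fin that by simp
    then show "\<forall>\<^sub>F M in sequentially. finite (?A M) \<and> X \<subseteq> ?A M \<and> ?A M \<subseteq> multi_indices n"
      using eventually_sequentially by blast
  qed
  then show ?thesis
    using assms filterlim_compose unfolding has_sum_def by blast
qed

section \<open>Zeros of power series in one variable\<close>

lemma fsigma_ball: "fsigma (ball (z :: 'a::metric_space) r)"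
proof -
  have "\<exists>n. d \<le> r - inverse (real (Suc n))" if "d < r" for d
  proof -
    obtain n where "inverse (real (Suc n)) < r - d"
      using reals_Archimedean[of "r - d"] \<open>d < r\<close> by auto
    then show ?thesis
      by (intro exI[of _ n]) linarith
  qed
  moreover have "d < r" if "d \<le> r - inverse (real (Suc n))" for d n
  proof -
    have "inverse (real (Suc n)) > 0"
      by simp
    then show ?thesis
      using that by linarith
  qed
  ultimately have "ball z r = (\<Union>n. cball z (r - inverse (real (Suc n))))"
    unfolding set_eq_iff mem_ball UN_iff mem_cball by blast
  then show ?thesis
    by (metis closed_cball fsigma.intros)
qed

text \<open>The series extends to a holomorphic function \<open>F\<close> on the complex disc with
  the same centre and radius. If \<open>F\<close> is not constant, its zeros are countable; if it is
  constant, the nonzero coefficient makes the constant nonzero and there are no zeros.\<close>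

lemma countable_zeros_real_power_series:
  fixes c :: "nat \<Rightarrow> real"
  assumes "r > 0"
    and f: "\<And>t. \<bar>t - x\<bar> < r \<Longrightarrow> (\<lambda>k. c k * (t - x) ^ k) sums f t"
    and "c m \<noteq> 0"
  shows "countable {t. \<bar>t - x\<bar> < r \<and> f t = 0}"
proof -
  define C where "C k = complex_of_real (c k)" for k
  define F where "F z = (\<Sum>k. C k * (z - of_real x) ^ k)" for z
  have sums_F: "(\<lambda>k. C k * (z - of_real x) ^ k) sums F z" if "z \<in> ball (of_real x) r" for z
  proof -
    \<comment> \<open>Convergence at the real point \<open>x + s\<close>, farther from the centre
      than \<open>z\<close>, gives convergence at \<open>z\<close>.\<close>
    from that obtain s where s: "norm (z - of_real x) < s" "s < r"
      using dense[of "dist (of_real x) z" r] by (auto simp: dist_norm norm_minus_commute)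
    then have "0 < s"
      by (meson norm_ge_zero order_le_less_trans)
    then have "summable (\<lambda>k. c k * s ^ k)"
      using f[of "x + s"] s by (auto simp: sums_iff)
    then have "summable (\<lambda>k. C k * of_real s ^ k)"
      using summable_of_real[of "\<lambda>k. c k * s ^ k", where 'a = complex] by (simp add: C_def)
    then have "summable (\<lambda>k. C k * (z - of_real x) ^ k)"
      by (rule powser_inside) (use s \<open>0 < s\<close> in auto)
    then show ?thesis
      by (simp add: F_def summable_sums)
  qed
  have F_real: "F (of_real t) = of_real (f t)" if "\<bar>t - x\<bar> < r" for t
  proof -
    have "(\<lambda>k. C k * (of_real t - of_real x) ^ k) sums of_real (f t)"
      using sums_of_real[OF f[OF that], where 'a = complex] by (simp add: C_def)
    then show ?thesis
      by (simp add: F_def sums_iff)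
  qed
  have of_real_in_ball: "complex_of_real t \<in> ball (of_real x) r \<longleftrightarrow> \<bar>t - x\<bar> < r" for t
    by (simp add: dist_norm norm_minus_commute abs_minus_commute flip: of_real_diff)
  show ?thesis
  proof (cases "F constant_on ball (of_real x) r")
    case False
    have "F holomorphic_on ball (of_real x) r"
      using sums_F by (rule power_series_holomorphic)
    then have "countable {z \<in> ball (of_real x) r. F z = 0}"
      using False by (intro holomorphic_countable_zeros) (auto simp: fsigma_ball)
    moreover have "complex_of_real ` {t. \<bar>t - x\<bar> < r \<and> f t = 0} \<subseteq> {z \<in> ball (of_real x) r. F z = 0}"
      using F_real by (auto simp: of_real_in_ball simp del: mem_ball)
    ultimately have "countable (complex_of_real ` {t. \<bar>t - x\<bar> < r \<and> f t = 0})"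
      using countable_subset by blast
    then show ?thesis
      by (rule countable_image_inj_on) (simp add: inj_on_def)
  next
    case True
    then obtain w where w: "F z = w" if "z \<in> ball (of_real x) r" for z
      unfolding constant_on_def by blast
    have const: "f t = f x" if "\<bar>t - x\<bar> < r" for t
    proof -
      have "F (of_real t) = F (of_real x)"
        using w of_real_in_ball[of t] of_real_in_ball[of x] that \<open>r > 0\<close> by simp
      then show ?thesis
        using F_real[OF that] F_real[of x] \<open>r > 0\<close> by simp
    qed
    \<comment> \<open>If the constant value were 0, then \<open>c 0 = 0\<close> and a later
      coefficient is nonzero, so the zero at \<open>x\<close> is isolated, contradicting
      constancy.\<close>
    have "f x \<noteq> 0"
    proof
      assume "f x = 0"
      have "f x = c 0"
        using f[of x] \<open>r > 0\<close> by (simp add: powser_sums_zero_iff)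
      with \<open>f x = 0\<close> \<open>c m \<noteq> 0\<close> have "m > 0"
        by (cases m) auto
      then obtain s where s: "s > 0" "\<And>t. t \<in> cball x s - {x} \<Longrightarrow> f t \<noteq> 0"
        using powser_0_nonzero[of r x c f m] f[folded real_norm_def] \<open>f x = 0\<close> \<open>c m \<noteq> 0\<close> \<open>r > 0\<close>
        by blast
      have "f (x + min s (r/2)) \<noteq> 0"
        using s(1) \<open>r > 0\<close> by (intro s(2)) (auto simp: dist_norm)
      then show False
        using const[of "x + min s (r/2)"] \<open>f x = 0\<close> s(1) \<open>r > 0\<close> by auto
    qed
    then have "{t. \<bar>t - x\<bar> < r \<and> f t = 0} = {}"
      using const by (metis (mono_tags, lifting) empty_Collect_eq)
    then show ?thesis
      using countable_empty by metis
  qed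
qed

section \<open>Zeros of power series in several variables\<close>

text \<open>The sum is a pointwise limit of polynomials in the coordinates
  \<open>\<psi> q i\<close>. Leaving \<open>\<psi>\<close> general covers both the identity on a
  box, with the product measure, and a chart on the manifold, with the Borel sets.\<close>

lemma sets_power_series_zeros:
  fixes a :: "(nat \<Rightarrow> nat) \<Rightarrow> real"
  assumes "B \<in> sets M"
    and [measurable]: "\<And>i. i < n \<Longrightarrow> (\<lambda>q. \<psi> q i) \<in> borel_measurable (restrict_space M B)"
    and f: "\<And>q. q \<in> B \<Longrightarrow>
      ((\<lambda>\<alpha>. (\<Prod>i<n. (\<psi> q i - x i) ^ \<alpha> i) *\<^sub>R a \<alpha>) has_sum f q) (multi_indices n)"
  shows "{q \<in> B. f q = 0} \<in> sets M"
proof -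
  have "f \<in> borel_measurable (restrict_space M B)"
  proof (rule borel_measurable_LIMSEQ_real)
    fix q assume "q \<in> space (restrict_space M B)"
    then have "q \<in> B"
      by (simp add: space_restrict_space)
    then show "(\<lambda>N. \<Sum>\<alpha>\<in>{\<alpha> \<in> multi_indices n. \<forall>i<n. \<alpha> i \<le> N}.
        (\<Prod>i<n. (\<psi> q i - x i) ^ \<alpha> i) *\<^sub>R a \<alpha>) \<longlonglongrightarrow> f q"
      by (intro has_sum_multi_indices_LIMSEQ f)
  next
    fix N
    show "(\<lambda>q. \<Sum>\<alpha>\<in>{\<alpha> \<in> multi_indices n. \<forall>i<n. \<alpha> i \<le> N}.
        (\<Prod>i<n. (\<psi> q i - x i) ^ \<alpha> i) *\<^sub>R a \<alpha>) \<in> borel_measurable (restrict_space M B)"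
      by measurable
  qed
  then have "{q \<in> space (restrict_space M B). f q = 0} \<in> sets (restrict_space M B)"
    by measurable
  moreover have "{q \<in> space (restrict_space M B). f q = 0} = {q \<in> B. f q = 0}"
    using sets.sets_into_space[OF \<open>B \<in> sets M\<close>] by (auto simp: space_restrict_space)
  ultimately show ?thesis
    using \<open>B \<in> sets M\<close> sets.sets_into_space[OF \<open>B \<in> sets M\<close>]
    by (auto simp: sets_restrict_space_iff Int_absorb2)
qed

lemma sets_open_box: "open_box n x r \<in> sets (PiM {..<n} (\<lambda>_. lborel))"
  unfolding open_box_def by (intro sets_PiM_I_finite) auto

lemma emeasure_open_box_pos:
  assumes "r > 0"
  shows "emeasure (PiM {..<n} (\<lambda>_. lborel)) (open_box n x r) > 0"
proof -
  interpret product_sigma_finite "\<lambda>_. lborel :: real measure"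
    by standard
  have "emeasure (PiM {..<n} (\<lambda>_. lborel)) (open_box n x r) = (\<Prod>i<n. ennreal (2 * r))"
    unfolding open_box_def using assms by (subst emeasure_PiM) auto
  also have "\<dots> > 0"
    using assms by (simp add: ennreal_power)
  finally show ?thesis .
qed

text \<open>By induction on the dimension: expanding in powers of the last coordinate, some coefficient
  is not identically zero, so by the induction hypothesis almost every line in that direction carries a
  nonzero one-variable power series; Fubini's theorem concludes.\<close>

lemma power_series_zero_set_null:
  fixes f :: "(nat \<Rightarrow> real) \<Rightarrow> real"
  assumes "r > 0"
    and "\<And>y. y \<in> open_box n x r \<Longrightarrow>
      ((\<lambda>\<alpha>. (\<Prod>i<n. (y i - x i) ^ \<alpha> i) *\<^sub>R a \<alpha>) has_sum f y) (multi_indices n)"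
  shows "(\<forall>y \<in> open_box n x r. f y = 0) \<or>
    {y \<in> open_box n x r. f y = 0} \<in> null_sets (PiM {..<n} (\<lambda>_. lborel))"
  using assms(2)
proof (induction n arbitrary: a f)
  case 0
  \<comment> \<open>In dimension 0 the box is a single point: either \<open>f\<close> vanishes there
    or it has no zeros at all.\<close>
  have "open_box 0 x r = {\<lambda>_. undefined}"
    by (auto simp: open_box_def)
  then show ?case
    by (cases "f (\<lambda>_. undefined) = 0") (auto simp: Collect_conv_if)
next
  case (Suc n)
  define mon where "mon y \<alpha> = (\<Prod>i<n. (y i - x i) ^ \<alpha> i)" for y and \<alpha> :: "nat \<Rightarrow> nat"
  have mon_upd: "(\<Prod>i<Suc n. ((y(n := t)) i - x i) ^ (\<alpha>(n := k)) i) = (t - x n) ^ k * mon y \<alpha>"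
    for y t \<alpha> k
    by (simp add: mon_def)
  have upd: "y(n := t) \<in> open_box (Suc n) x r" if "y \<in> open_box n x r" "\<bar>t - x n\<bar> < r" for y t
    using that by (auto simp: open_box_iff extensional_def less_Suc_eq)
  have series: "((\<lambda>(k, \<alpha>). (t - x n) ^ k * (mon y \<alpha> * a (\<alpha>(n := k)))) has_sum f (y(n := t)))
      (UNIV \<times> multi_indices n)" if "y \<in> open_box n x r" "\<bar>t - x n\<bar> < r" for y t
  proof -
    have "((\<lambda>p. (\<Prod>i<Suc n. ((y(n := t)) i - x i) ^ (case p of (k, \<alpha>) \<Rightarrow> \<alpha>(n := k)) i) *\<^sub>R
        a (case p of (k, \<alpha>) \<Rightarrow> \<alpha>(n := k))) has_sum f (y(n := t))) (UNIV \<times> multi_indices n)"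
      using Suc.prems[OF upd[OF that]]
      by (subst has_sum_reindex_bij_betw[OF bij_betw_multi_indices_Suc])
    then show ?thesis
      by (rule has_sum_cong[THEN iffD1, rotated])
        (simp add: mon_upd mult.assoc split: prod.split del: prod.lessThan_Suc fun_upd_apply)
  qed
  \<comment> \<open>\<open>g k y\<close> is the coefficient of the \<open>k\<close>-th power of the
    last coordinate, itself a power series in the first \<open>n\<close> coordinates.\<close>
  define g where "g k y = (\<Sum>\<^sub>\<infinity>\<alpha>\<in>multi_indices n. mon y \<alpha> * a (\<alpha>(n := k)))" for k y
  have g: "((\<lambda>\<alpha>. mon y \<alpha> * a (\<alpha>(n := k))) has_sum g k y) (multi_indices n)"
    if "y \<in> open_box n x r" for k y
  proof -
    \<comment> \<open>Fixing the last displacement at the nonzero value \<open>r / 2\<close> gives a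
      summable double family. Each row is then summable, and the factor \<open>(r / 2) ^ k\<close>
      can be cancelled.\<close>
    have "(\<lambda>(k, \<alpha>). (r / 2) ^ k * (mon y \<alpha> * a (\<alpha>(n := k)))) summable_on UNIV \<times> multi_indices n"
      using series[OF that, of "x n + r / 2"] \<open>r > 0\<close> by (auto simp: summable_on_def)
    then have "(\<lambda>\<alpha>. (r / 2) ^ k * (mon y \<alpha> * a (\<alpha>(n := k)))) summable_on multi_indices n"
      by (rule summable_on_SigmaD1) simp
    then have "(\<lambda>\<alpha>. mon y \<alpha> * a (\<alpha>(n := k))) summable_on multi_indices n"
      using \<open>r > 0\<close> by (subst (asm) summable_on_cmult_right') auto
    then show ?thesis
      unfolding g_def by (rule has_sum_infsum)
  qed
  have sums: "(\<lambda>k. g k y * (t - x n) ^ k) sums f (y(n := t))"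
    if "y \<in> open_box n x r" "\<bar>t - x n\<bar> < r" for y t
  proof (rule has_sum_imp_sums)
    show "((\<lambda>k. g k y * (t - x n) ^ k) has_sum f (y(n := t))) UNIV"
      using series[OF that]
      by (rule has_sum_SigmaD)
        (use has_sum_cmult_right[OF g[OF that(1)]] in \<open>simp add: mult.commute[of "g _ y"]\<close>)
  qed
  show ?case
  proof (cases "\<forall>k. \<forall>y \<in> open_box n x r. g k y = 0")
    case True
    have "f z = 0" if z: "z \<in> open_box (Suc n) x r" for z
    proof -
      have "restrict z {..<n} \<in> open_box n x r" "\<bar>z n - x n\<bar> < r"
        using z by (auto simp: open_box_iff)
      from sums[OF this] True this(1) have "f ((restrict z {..<n})(n := z n)) = 0"
        by (simp add: sums_iff)
      moreover have "(restrict z {..<n})(n := z n) = z"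
        using z by (auto simp: open_box_iff extensional_def fun_eq_iff)
      ultimately show ?thesis
        by simp
    qed
    then show ?thesis
      by blast
  next
    case False
    then obtain k where k: "\<not> (\<forall>y \<in> open_box n x r. g k y = 0)"
      by blast
    \<comment> \<open>The exceptional base points: off \<open>N\<close> the line over a point of the
      box carries a series whose \<open>k\<close>-th coefficient is nonzero.\<close>
    define N where "N = {y \<in> open_box n x r. g k y = 0}"
    have "N \<in> null_sets (PiM {..<n} (\<lambda>_. lborel))"
      unfolding N_def using Suc.IH[of "\<lambda>\<alpha>. a (\<alpha>(n := k))" "g k"] g k by (simp add: mon_def)
    define Z where "Z = {y \<in> open_box (Suc n) x r. f y = 0}"
    have Z [measurable]: "Z \<in> sets (PiM {..<Suc n} (\<lambda>_. lborel))"
      unfolding Z_def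
    proof (rule sets_power_series_zeros[OF sets_open_box _ Suc.prems])
      show "(\<lambda>y. y i) \<in> borel_measurable
          (restrict_space (PiM {..<Suc n} (\<lambda>_. lborel)) (open_box (Suc n) x r))" if "i < Suc n" for i
        using that by (intro measurable_restrict_space1) (metis lessThan_iff measurable_component_singleton measurable_lborel1)
    qed
    have slice: "(\<integral>\<^sup>+t. indicator Z (y(n := t)) \<partial>lborel) = 0"
      if y: "y \<in> extensional {..<n}" "y \<notin> N" for y
    proof (cases "y \<in> open_box n x r")
      case True
      then have "countable {t. \<bar>t - x n\<bar> < r \<and> f (y(n := t)) = 0}"
        using sums y(2) \<open>r > 0\<close>
        by (intro countable_zeros_real_power_series[where c = "\<lambda>k. g k y" and m = k]) (auto simp: N_def)
      then have "{t. \<bar>t - x n\<bar> < r \<and> f (y(n := t)) = 0} \<in> null_sets lborel"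
        by (rule countable_imp_null_set_lborel)
      then have "AE t in lborel. \<not> (\<bar>t - x n\<bar> < r \<and> f (y(n := t)) = 0)"
        using AE_not_in by force
      moreover have "\<bar>t - x n\<bar> < r \<and> f (y(n := t)) = 0" if "y(n := t) \<in> Z" for t
      proof -
        have "\<bar>(y(n := t)) n - x n\<bar> < r"
          using that unfolding Z_def open_box_iff by blast
        then show ?thesis
          using that by (simp add: Z_def)
      qed
      ultimately have "AE t in lborel. indicator Z (y(n := t)) = (0 :: ennreal)"
        by (auto simp: indicator_def elim!: eventually_mono)
      then have "(\<integral>\<^sup>+t. indicator Z (y(n := t)) \<partial>lborel) = (\<integral>\<^sup>+(t::real). 0 \<partial>lborel)"
        by (rule nn_integral_cong_AE)
      then show ?thesis
        by simp
    next
      \<comment> \<open>The whole line over a base point outside the box misses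
        \<open>Z\<close>.\<close>
      case False
      then obtain i where i: "i < n" "\<not> \<bar>y i - x i\<bar> < r"
        using y(1) by (auto simp: open_box_iff)
      have "y(n := t) \<notin> Z" for t
      proof
        assume "y(n := t) \<in> Z"
        then have "\<bar>(y(n := t)) i - x i\<bar> < r"
          using less_SucI[OF i(1)] unfolding Z_def open_box_iff by blast
        then show False
          using i by simp
      qed
      then show ?thesis
        by simp
    qed
    interpret product_sigma_finite "\<lambda>_. lborel :: real measure"
      by standard
    have "emeasure (PiM {..<Suc n} (\<lambda>_. lborel)) Z =
        (\<integral>\<^sup>+y. indicator Z y \<partial>PiM (insert n {..<n}) (\<lambda>_. lborel))"
      using Z by (simp add: lessThan_Suc)
    also have "\<dots> = (\<integral>\<^sup>+y. (\<integral>\<^sup>+t. indicator Z (y(n := t)) \<partial>lborel) \<partial>PiM {..<n} (\<lambda>_. lborel))"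
      using Z by (intro product_nn_integral_insert) (auto simp: lessThan_Suc)
    also have "\<dots> = (\<integral>\<^sup>+y. 0 \<partial>PiM {..<n} (\<lambda>_. lborel :: real measure))"
    proof (rule nn_integral_cong_AE)
      show "AE y in PiM {..<n} (\<lambda>_. lborel). (\<integral>\<^sup>+t. indicator Z (y(n := t)) \<partial>lborel) = 0"
        using AE_not_in[OF \<open>N \<in> null_sets _\<close>] AE_space
      proof eventually_elim
        case (elim y)
        then show ?case
          by (intro slice) (auto simp: space_PiM PiE_def)
      qed
    qed
    finally have "Z \<in> null_sets (PiM {..<Suc n} (\<lambda>_. lborel))"
      using Z by (simp add: null_sets_def)
    then show ?thesis
      by (simp add: Z_def)
  qed
qed

section \<open>Real-analytic functions and minors\<close>

lemma real_analytic_on_iff: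
  "real_analytic_on n W f \<longleftrightarrow> (\<forall>x\<in>W. \<exists>r>0. \<exists>a. \<forall>y\<in>W. (\<forall>i<n. \<bar>y i - x i\<bar> < r) \<longrightarrow>
     ((\<lambda>\<alpha>. (\<Prod>i<n. (y i - x i) ^ \<alpha> i) *\<^sub>R a \<alpha>) has_sum f y) (multi_indices n))"
  by (simp add: real_analytic_on_def multi_indices_def)

lemma real_analytic_on_bounded_linear:
  assumes "bounded_linear h" "real_analytic_on n W f"
  shows "real_analytic_on n W (\<lambda>x. h (f x))"
  unfolding real_analytic_on_iff
proof
  interpret bounded_linear h by fact
  fix x assume "x \<in> W"
  then obtain r a where "r > 0" and a: "\<And>y. y \<in> W \<Longrightarrow> (\<forall>i<n. \<bar>y i - x i\<bar> < r) \<Longrightarrow>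
      ((\<lambda>\<alpha>. (\<Prod>i<n. (y i - x i) ^ \<alpha> i) *\<^sub>R a \<alpha>) has_sum f y) (multi_indices n)"
    using assms(2) unfolding real_analytic_on_iff by blast
  have "((\<lambda>\<alpha>. (\<Prod>i<n. (y i - x i) ^ \<alpha> i) *\<^sub>R h (a \<alpha>)) has_sum h (f y)) (multi_indices n)"
    if "y \<in> W" "\<forall>i<n. \<bar>y i - x i\<bar> < r" for y
    using has_sum_bounded_linear[OF assms(1) a[OF that]] by (simp add: scaleR)
  then show "\<exists>r>0. \<exists>a. \<forall>y\<in>W. (\<forall>i<n. \<bar>y i - x i\<bar> < r) \<longrightarrow>
     ((\<lambda>\<alpha>. (\<Prod>i<n. (y i - x i) ^ \<alpha> i) *\<^sub>R a \<alpha>) has_sum h (f y)) (multi_indices n)"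
    using \<open>r > 0\<close> by (intro exI[of _ r] conjI exI[of _ "\<lambda>\<alpha>. h (a \<alpha>)"]) auto
qed

text \<open>Shared by sums and products: both expansions hold within the smaller of the two radii,
  and \<open>c\<close> says how the coefficient families are combined.\<close>

lemma real_analytic_on_combine:
  assumes "real_analytic_on n W f" "real_analytic_on n W g"
    and comb: "\<And>x y a b.
      ((\<lambda>\<alpha>. (\<Prod>i<n. (y i - x i) ^ \<alpha> i) *\<^sub>R a \<alpha>) has_sum f y) (multi_indices n) \<Longrightarrow>
      ((\<lambda>\<alpha>. (\<Prod>i<n. (y i - x i) ^ \<alpha> i) *\<^sub>R b \<alpha>) has_sum g y) (multi_indices n) \<Longrightarrow>
      ((\<lambda>\<alpha>. (\<Prod>i<n. (y i - x i) ^ \<alpha> i) *\<^sub>R c a b \<alpha>) has_sum h y) (multi_indices n)"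
  shows "real_analytic_on n W h"
  unfolding real_analytic_on_iff
proof
  fix x assume "x \<in> W"
  obtain r a where "r > 0" and a: "\<And>y. y \<in> W \<Longrightarrow> (\<forall>i<n. \<bar>y i - x i\<bar> < r) \<Longrightarrow>
      ((\<lambda>\<alpha>. (\<Prod>i<n. (y i - x i) ^ \<alpha> i) *\<^sub>R a \<alpha>) has_sum f y) (multi_indices n)"
    using assms(1) \<open>x \<in> W\<close> unfolding real_analytic_on_iff by blast
  obtain s b where "s > 0" and b: "\<And>y. y \<in> W \<Longrightarrow> (\<forall>i<n. \<bar>y i - x i\<bar> < s) \<Longrightarrow>
      ((\<lambda>\<alpha>. (\<Prod>i<n. (y i - x i) ^ \<alpha> i) *\<^sub>R b \<alpha>) has_sum g y) (multi_indices n)"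
    using assms(2) \<open>x \<in> W\<close> unfolding real_analytic_on_iff by blast
  have "((\<lambda>\<alpha>. (\<Prod>i<n. (y i - x i) ^ \<alpha> i) *\<^sub>R c a b \<alpha>) has_sum h y) (multi_indices n)"
    if "y \<in> W" "\<forall>i<n. \<bar>y i - x i\<bar> < min r s" for y
    using that by (intro comb a b) auto
  then show "\<exists>r>0. \<exists>a. \<forall>y\<in>W. (\<forall>i<n. \<bar>y i - x i\<bar> < r) \<longrightarrow>
     ((\<lambda>\<alpha>. (\<Prod>i<n. (y i - x i) ^ \<alpha> i) *\<^sub>R a \<alpha>) has_sum h y) (multi_indices n)"
    using \<open>r > 0\<close> \<open>s > 0\<close> by (intro exI[of _ "min r s"] conjI exI[of _ "c a b"]) auto
qed

lemma real_analytic_on_add: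
  assumes "real_analytic_on n W f" "real_analytic_on n W g"
  shows "real_analytic_on n W (\<lambda>x. f x + g x)"
  using assms
  by (rule real_analytic_on_combine[where c = "\<lambda>a b \<alpha>. a \<alpha> + b \<alpha>"])
    (simp add: scaleR_add_right has_sum_add)

lemma real_analytic_on_diff:
  assumes "real_analytic_on n W f" "real_analytic_on n W g"
  shows "real_analytic_on n W (\<lambda>x. f x - g x)"
  using real_analytic_on_add[OF assms(1)
      real_analytic_on_bounded_linear[OF bounded_linear_minus[OF bounded_linear_ident] assms(2)]]
  by simp

text \<open>Unconditional summability of reals is absolute, so the family of products is absolutely
  summable and may be summed iteratedly.\<close>

lemma has_sum_times_real:
  fixes f :: "'a \<Rightarrow> real" and g :: "'b \<Rightarrow> real"
  assumes f: "(f has_sum S) A" and g: "(g has_sum T) B"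
  shows "((\<lambda>(x, y). f x * g y) has_sum S * T) (A \<times> B)"
proof (rule has_sum_SigmaI)
  show "((\<lambda>y. case (x, y) of (x, y) \<Rightarrow> f x * g y) has_sum f x * T) B" for x
    using has_sum_cmult_right[OF g] by simp
  show "((\<lambda>x. f x * T) has_sum S * T) A"
    using has_sum_cmult_left[OF f] by simp
  have "(\<lambda>x. norm (f x)) summable_on A" "(\<lambda>y. norm (g y)) summable_on B"
    unfolding summable_on_iff_abs_summable_on_real[symmetric]
    using f g by (auto simp: summable_on_def)
  then have "(\<lambda>p. norm (case p of (x, y) \<Rightarrow> f x * g y)) summable_on A \<times> B"
    by (intro Infinite_Sum.abs_summable_on_Sigma_iff[THEN iffD2] conjI ballI)
      (auto simp: abs_mult infsum_cmult_right' intro: summable_on_cmult_right summable_on_cmult_left)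
  then show "(\<lambda>(x, y). f x * g y) summable_on A \<times> B"
    by (rule Infinite_Sum.abs_summable_summable)
qed

lemma finite_multi_indices_le:
  assumes "\<gamma> \<in> multi_indices n"
  shows "finite {\<alpha>. \<forall>i. \<alpha> i \<le> \<gamma> i}"
proof (rule finite_subset[OF _ finite_set_of_finite_funs[of "{..<n}" "\<Union>i<n. {..\<gamma> i}" 0]])
  show "{\<alpha>. \<forall>i. \<alpha> i \<le> \<gamma> i} \<subseteq>
      {\<alpha>. \<forall>i. (i \<in> {..<n} \<longrightarrow> \<alpha> i \<in> (\<Union>i<n. {..\<gamma> i})) \<and> (i \<notin> {..<n} \<longrightarrow> \<alpha> i = 0)}"
    using assms by (auto simp: multi_indices_def) (metis le_zero_eq not_le)
qed auto

text \<open>Pairs \<open>(\<alpha>, \<beta>)\<close> correspond to pairs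
  \<open>(\<gamma>, \<alpha>)\<close> with \<open>\<gamma> = \<alpha> + \<beta>\<close> and
  \<open>\<alpha> \<le> \<gamma>\<close> pointwise. The product family, reindexed in this way, is
  first summed over the finite fibre of each \<open>\<gamma>\<close>.\<close>

lemma has_sum_Cauchy_product_multi_indices:
  fixes a b :: "(nat \<Rightarrow> nat) \<Rightarrow> real"
  assumes a: "((\<lambda>\<alpha>. (\<Prod>i<n. z i ^ \<alpha> i) * a \<alpha>) has_sum S) (multi_indices n)"
    and b: "((\<lambda>\<alpha>. (\<Prod>i<n. z i ^ \<alpha> i) * b \<alpha>) has_sum T) (multi_indices n)"
  shows "((\<lambda>\<gamma>. (\<Prod>i<n. z i ^ \<gamma> i) * (\<Sum>\<alpha> | \<forall>i. \<alpha> i \<le> \<gamma> i. a \<alpha> * b (\<lambda>i. \<gamma> i - \<alpha> i)))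
    has_sum S * T) (multi_indices n)"
proof -
  let ?J = "Sigma (multi_indices n) (\<lambda>\<gamma>. {\<alpha>. \<forall>i. \<alpha> i \<le> \<gamma> i})"
  let ?split = "\<lambda>(\<gamma>, \<alpha>). (\<alpha>, \<lambda>i. \<gamma> i - \<alpha> i) :: (nat \<Rightarrow> nat) \<times> (nat \<Rightarrow> nat)"
  have bij: "bij_betw ?split ?J (multi_indices n \<times> multi_indices n)"
  proof (rule bij_betwI[where g = "\<lambda>(\<alpha>, \<beta>). (\<lambda>i. \<alpha> i + \<beta> i, \<alpha>)"])
    show "?split \<in> ?J \<rightarrow> multi_indices n \<times> multi_indices n"
      by (auto simp: multi_indices_def) (metis le_zero_eq)
  qed (auto simp: multi_indices_def fun_eq_iff)
  have mon: "(\<Prod>i<n. z i ^ \<alpha> i) * (\<Prod>i<n. z i ^ (\<gamma> i - \<alpha> i)) = (\<Prod>i<n. z i ^ \<gamma> i)"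
    if "\<forall>i. \<alpha> i \<le> \<gamma> i" for \<alpha> \<gamma>
    using that by (simp flip: prod.distrib power_add)
  have "((\<lambda>p. case ?split p of (\<alpha>, \<beta>) \<Rightarrow>
      ((\<Prod>i<n. z i ^ \<alpha> i) * a \<alpha>) * ((\<Prod>i<n. z i ^ \<beta> i) * b \<beta>)) has_sum S * T) ?J"
    using has_sum_times_real[OF a b] by (subst has_sum_reindex_bij_betw[OF bij])
  then have "((\<lambda>(\<gamma>, \<alpha>). (\<Prod>i<n. z i ^ \<gamma> i) * (a \<alpha> * b (\<lambda>i. \<gamma> i - \<alpha> i))) has_sum S * T) ?J"
  proof (rule has_sum_cong[THEN iffD1, rotated])
    fix p assume "p \<in> ?J"
    then obtain \<gamma> \<alpha> where p: "p = (\<gamma>, \<alpha>)" "\<forall>i. \<alpha> i \<le> \<gamma> i"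
      by auto
    show "(case ?split p of (\<alpha>, \<beta>) \<Rightarrow>
        ((\<Prod>i<n. z i ^ \<alpha> i) * a \<alpha>) * ((\<Prod>i<n. z i ^ \<beta> i) * b \<beta>)) =
        (case p of (\<gamma>, \<alpha>) \<Rightarrow> (\<Prod>i<n. z i ^ \<gamma> i) * (a \<alpha> * b (\<lambda>i. \<gamma> i - \<alpha> i)))"
      unfolding p(1) by (simp flip: mon[OF p(2)])
  qed
  then show ?thesis
  proof (rule has_sum_SigmaD)
    fix \<gamma> assume "\<gamma> \<in> multi_indices n"
    then show "((\<lambda>\<alpha>. case (\<gamma>, \<alpha>) of (\<gamma>, \<alpha>) \<Rightarrow> (\<Prod>i<n. z i ^ \<gamma> i) * (a \<alpha> * b (\<lambda>i. \<gamma> i - \<alpha> i)))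
        has_sum (\<Prod>i<n. z i ^ \<gamma> i) * (\<Sum>\<alpha> | \<forall>i. \<alpha> i \<le> \<gamma> i. a \<alpha> * b (\<lambda>i. \<gamma> i - \<alpha> i)))
        {\<alpha>. \<forall>i. \<alpha> i \<le> \<gamma> i}"
      unfolding sum_distrib_left prod.case by (intro has_sum_finite finite_multi_indices_le)
  qed
qed

lemma real_analytic_on_mult:
  fixes f g :: "(nat \<Rightarrow> real) \<Rightarrow> real"
  assumes "real_analytic_on n W f" "real_analytic_on n W g"
  shows "real_analytic_on n W (\<lambda>x. f x * g x)"
  using assms
  by (rule real_analytic_on_combine[where
        c = "\<lambda>a b \<gamma>. \<Sum>\<alpha> | \<forall>i. \<alpha> i \<le> \<gamma> i. a \<alpha> * b (\<lambda>i. \<gamma> i - \<alpha> i)"])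
    (unfold real_scaleR_def, rule has_sum_Cauchy_product_multi_indices)

section \<open>Vanishing and analyticity of the minors\<close>

text \<open>All rows are multiples of one vector \<open>v\<close>, so the entries have the form
  \<open>k i * v $ j\<close> and the two products in the determinant cancel.\<close>

lemma minor2_eq_0_if_rank_le_1:
  fixes M :: "complex^'n^'m"
  assumes "rank M \<le> 1"
  shows "minor2 M r s = 0"
proof -
  obtain B where B: "B \<subseteq> rows M" "vec.independent B" "rows M \<subseteq> vec.span B" "card B = vec.dim (rows M)"
    using vec.basis_exists[of "rows M"] by blast
  have "finite B"
    using B(2) vec.finiteI_independent by blast
  moreover have "card B \<le> 1"
    using assms B(4) by (simp add: row_rank_def_gen)
  \<comment> \<open>\<open>B\<close> may be empty; then any \<open>v\<close> serves, and all rows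
    are zero.\<close>
  ultimately obtain v where "B \<subseteq> {v}"
    by (metis card_le_Suc0_iff_eq One_nat_def insert_iff subsetI)
  then have "rows M \<subseteq> vec.span {v}"
    using B(3) vec.span_mono by blast
  then have "row i M \<in> range (\<lambda>k. k *s v)" for i
    using vec.span_singleton by (auto simp: rows_def)
  then have "\<forall>i. \<exists>k. row i M = k *s v"
    by auto
  then obtain k where k: "\<And>i. row i M = k i *s v"
    by metis
  have "M $ i $ j = k i * v $ j" for i j
    using k[of i] by (auto simp: row_def vec_eq_iff)
  then show ?thesis
    by (simp add: minor2_def det_2)
qed

text \<open>The real and imaginary parts of a minor are polynomials in those of the entries, and the
  latter are real-linear in the block data.\<close>

lemma real_analytic_on_re_im_minors:
  fixes M :: "'g::finite block_data \<Rightarrow> complex^'n^'m"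
  assumes "h \<in> re_im_minors M" "real_analytic_on n W F"
    and lin: "\<And>i j. linear (\<lambda>X. M X $ i $ j)"
  shows "real_analytic_on n W (\<lambda>x. h (F x))"
proof -
  have bl: "bounded_linear (\<lambda>X. M X $ i $ j)" for i j
    using lin by (simp add: linear_conv_bounded_linear)
  have Re: "real_analytic_on n W (\<lambda>x. Re (M (F x) $ i $ j))" for i j
    using bounded_linear_compose[OF bounded_linear_Re bl] assms(2)
    by (rule real_analytic_on_bounded_linear)
  have Im: "real_analytic_on n W (\<lambda>x. Im (M (F x) $ i $ j))" for i j
    using bounded_linear_compose[OF bounded_linear_Im bl] assms(2)
    by (rule real_analytic_on_bounded_linear)
  obtain r s where "h = (\<lambda>X. Re (minor2 (M X) r s)) \<or> h = (\<lambda>X. Im (minor2 (M X) r s))"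
    using assms(1) unfolding re_im_minors_def by blast
  then show ?thesis
  proof
    assume "h = (\<lambda>X. Re (minor2 (M X) r s))"
    then show ?thesis
      by (simp add: minor2_def det_2)
        (intro Re Im real_analytic_on_diff real_analytic_on_mult)
  next
    assume "h = (\<lambda>X. Im (minor2 (M X) r s))"
    then show ?thesis
      by (simp add: minor2_def det_2)
        (intro Re Im real_analytic_on_add real_analytic_on_diff real_analytic_on_mult)
  qed
qed

text \<open>Linearity is over the reals: the entries of \<open>aug_12_F\<close> are only conjugate
  linear in \<open>F\<close>.\<close>

lemma linear_aug_nth:
  "linear (\<lambda>X :: 'g::finite block_data. aug_01_D X $ i $ j)"
  "linear (\<lambda>X :: 'g::finite block_data. aug_12_E X $ i $ j)"
  "linear (\<lambda>X :: 'g::finite block_data. aug_01_F X $ i $ k)"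
  "linear (\<lambda>X :: 'g::finite block_data. aug_12_F X $ i $ k)"
  by (rule linearI;
      auto simp: hconcat_def columnvector_def conj_transpose_def complex_eq_iff split: sum.split)+

lemma real_analytic_on_minor_functions:
  assumes "h \<in> minor_functions" "real_analytic_on n W F"
  shows "real_analytic_on n W (\<lambda>x. h (F x))"
  using assms unfolding minor_functions_def
  by (auto intro: real_analytic_on_re_im_minors linear_aug_nth)

lemma minor_functions_eq_0_if_rank_one_conditions:
  assumes "h \<in> minor_functions" "rank_one_conditions X"
  shows "h X = 0"
  using assms
  by (cases X) (auto simp: minor_functions_def re_im_minors_def minor2_eq_0_if_rank_le_1)

section \<open>Zero sets of analytic functions on manifolds\<close>

lemma openin_open_box: "openin (powertop_real {..<n}) (open_box n x r)"
  unfolding open_box_def by (subst openin_PiE) auto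

lemma openin_contains_open_box:
  assumes "openin (powertop_real {..<n}) V" "x \<in> V"
  obtains r where "r > 0" "open_box n x r \<subseteq> V"
proof -
  obtain X where X: "x \<in> (\<Pi>\<^sub>E i\<in>{..<n}. X i)" "\<forall>i. openin euclideanreal (X i)" "(\<Pi>\<^sub>E i\<in>{..<n}. X i) \<subseteq> V"
    using product_topology_open_contains_basis[OF assms] by (elim exE conjE) (rule that)
  have "\<forall>i\<in>{..<n}. \<exists>e>0. ball (x i) e \<subseteq> X i"
  proof
    fix i assume "i \<in> {..<n}"
    then have "x i \<in> X i"
      using X(1) by (rule PiE_mem[rotated])
    then show "\<exists>e>0. ball (x i) e \<subseteq> X i"
      using X(2) by (simp add: open_contains_ball)
  qed
  then obtain e where e: "\<And>i. i < n \<Longrightarrow> e i > 0" "\<And>i. i < n \<Longrightarrow> ball (x i) (e i) \<subseteq> X i"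
    by (metis lessThan_iff)
  \<comment> \<open>Inserting 1 keeps the minimum defined when \<open>n = 0\<close>.\<close>
  define r where "r = Min (insert 1 (e ` {..<n}))"
  have "r > 0"
    unfolding r_def using e(1) by (subst Min_gr_iff) auto
  moreover have "open_box n x r \<subseteq> V"
  proof
    fix y assume y: "y \<in> open_box n x r"
    have "y i \<in> X i" if "i < n" for i
    proof -
      have "r \<le> e i"
        unfolding r_def using that by (intro Min_le) auto
      then have "y i \<in> ball (x i) (e i)"
        using y that by (auto simp: open_box_iff dist_real_def abs_minus_commute intro: less_le_trans)
      then show ?thesis
        using e(2) that by blast
    qed
    then have "y \<in> (\<Pi>\<^sub>E i\<in>{..<n}. X i)"
      using y by (auto simp: open_box_iff PiE_iff)
    then show "y \<in> V"
      using X(3) by blast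
  qed
  ultimately show ?thesis
    by (rule that)
qed

lemma is_chart_openin_image:
  assumes "is_chart n (U, \<phi>)" "open V" "V \<subseteq> U"
  shows "openin (powertop_real {..<n}) (\<phi> ` V)"
proof -
  have "openin (top_of_set U) V"
    using assms by (simp add: is_chart_def openin_open_eq)
  then have "openin (subtopology (powertop_real {..<n}) (\<phi> ` U)) (\<phi> ` V)"
    using assms(1) homeomorphic_imp_open_map unfolding is_chart_def open_map_def by fastforce
  then show ?thesis
    using assms(1) by (simp add: is_chart_def openin_open_subtopology)
qed

lemma is_chart_continuous_map:
  assumes "is_chart n (U, \<phi>)"
  shows "continuous_map (top_of_set U) (powertop_real {..<n}) \<phi>"
  using assms
  by (auto simp: is_chart_def continuous_map_in_subtopology dest: homeomorphic_imp_continuous_map)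

lemma is_chart_inj_on:
  assumes "is_chart n (U, \<phi>)"
  shows "inj_on \<phi> U"
  using assms homeomorphic_imp_injective_map by (fastforce simp: is_chart_def)

text \<open>The image of a nonempty open set contains a box, which has positive measure.\<close>

lemma is_chart_image_not_subset_null:
  assumes "is_chart n (U, \<phi>)" "open V" "V \<subseteq> U" "V \<noteq> {}"
    and N: "N \<in> null_sets (PiM {..<n} (\<lambda>_. lborel))"
  shows "\<not> \<phi> ` V \<subseteq> N"
proof
  assume "\<phi> ` V \<subseteq> N"
  obtain p where "p \<in> V"
    using assms(4) by blast
  then obtain r where "r > 0" "open_box n (\<phi> p) r \<subseteq> \<phi> ` V"
    using openin_contains_open_box[OF is_chart_openin_image[OF assms(1-3)]] by blast
  then have "open_box n (\<phi> p) r \<in> null_sets (PiM {..<n} (\<lambda>_. lborel))"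
    using \<open>\<phi> ` V \<subseteq> N\<close> by (intro null_sets_subset[OF N sets_open_box]) blast
  then show False
    using emeasure_open_box_pos[OF \<open>r > 0\<close>, of n "\<phi> p"] by (simp add: null_setsD1)
qed

section \<open>Zero sets: from one chart to the whole manifold\<close>

text \<open>Pulls the alternative of \<open>power_series_zero_set_null\<close> back along a chart to
  a neighbourhood of \<open>p\<close>. The zeros are shown to be Borel on the manifold as well,
  since chart densities compute the volume of Borel sets only.\<close>

lemma analytic_zero_set_dichotomy:
  fixes f :: "'p::topological_space \<Rightarrow> real"
  assumes chart: "is_chart n (U, \<phi>)"
    and f: "real_analytic_on n (\<phi> ` U) (\<lambda>x. f (inv_into U \<phi> x))" and "p \<in> U"
  obtains W where "open W" "p \<in> W" "W \<subseteq> U" "{q \<in> W. f q = 0} \<in> sets borel"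
    "(\<forall>q\<in>W. f q = 0) \<or> \<phi> ` {q \<in> W. f q = 0} \<in> null_sets (PiM {..<n} (\<lambda>_. lborel))"
proof -
  define x where "x = \<phi> p"
  define F where "F y = f (inv_into U \<phi> y)" for y
  have F_\<phi>: "F (\<phi> q) = f q" if "q \<in> U" for q
    using is_chart_inj_on[OF chart] that by (simp add: F_def)
  have "open U"
    using chart by (simp add: is_chart_def)
  obtain s a where "s > 0" and a: "\<And>y. y \<in> \<phi> ` U \<Longrightarrow> (\<forall>i<n. \<bar>y i - x i\<bar> < s) \<Longrightarrow>
      ((\<lambda>\<alpha>. (\<Prod>i<n. (y i - x i) ^ \<alpha> i) *\<^sub>R a \<alpha>) has_sum F y) (multi_indices n)"
    using f \<open>p \<in> U\<close> unfolding real_analytic_on_iff F_def x_def by blast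
  obtain t where "t > 0" "open_box n x t \<subseteq> \<phi> ` U"
    using openin_contains_open_box[OF is_chart_openin_image[OF chart \<open>open U\<close> order_refl]] \<open>p \<in> U\<close>
    unfolding x_def by blast
  \<comment> \<open>Below \<open>s\<close> the expansion at \<open>x\<close> is valid, below
    \<open>t\<close> the box stays inside the image of the chart.\<close>
  define r where "r = min s t"
  have "r > 0"
    using \<open>s > 0\<close> \<open>t > 0\<close> by (simp add: r_def)
  have box: "open_box n x r \<subseteq> \<phi> ` U"
    using \<open>open_box n x t \<subseteq> \<phi> ` U\<close> by (auto simp: open_box_iff r_def)
  have series: "((\<lambda>\<alpha>. (\<Prod>i<n. (y i - x i) ^ \<alpha> i) *\<^sub>R a \<alpha>) has_sum F y) (multi_indices n)"
    if "y \<in> open_box n x r" for y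
    using that box by (intro a) (auto simp: open_box_iff r_def)
  define W where "W = {q \<in> U. \<phi> q \<in> open_box n x r}"
  have "W \<subseteq> U"
    by (auto simp: W_def)
  have "openin (top_of_set U) W"
    using openin_continuous_map_preimage[OF is_chart_continuous_map[OF chart] openin_open_box]
    by (simp add: W_def)
  then have "open W"
    using \<open>open U\<close> by (simp add: openin_open_eq)
  have "\<phi> p \<in> extensional {..<n}"
    using continuous_map_image_subset_topspace[OF is_chart_continuous_map[OF chart]] \<open>p \<in> U\<close>
    by (auto simp: PiE_def)
  then have "p \<in> W"
    using \<open>p \<in> U\<close> \<open>r > 0\<close> by (simp add: W_def open_box_iff x_def)
  have "(\<lambda>q. \<phi> q i) \<in> borel_measurable (restrict_space borel W)" if "i < n" for i
  proof (rule borel_measurable_continuous_on_restrict)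
    have "continuous_on U (\<lambda>q. \<phi> q i)"
      using is_chart_continuous_map[OF chart] that by (simp add: continuous_map_componentwise)
    then show "continuous_on W (\<lambda>q. \<phi> q i)"
      using \<open>W \<subseteq> U\<close> continuous_on_subset by blast
  qed
  moreover have "((\<lambda>\<alpha>. (\<Prod>i<n. (\<phi> q i - x i) ^ \<alpha> i) *\<^sub>R a \<alpha>) has_sum f q) (multi_indices n)"
    if "q \<in> W" for q
    using series[of "\<phi> q"] F_\<phi> that by (simp add: W_def)
  ultimately have "{q \<in> W. f q = 0} \<in> sets borel"
    by (rule sets_power_series_zeros[rotated]) (use borel_open[OF \<open>open W\<close>] in auto)
  moreover have "(\<forall>q\<in>W. f q = 0) \<or> \<phi> ` {q \<in> W. f q = 0} \<in> null_sets (PiM {..<n} (\<lambda>_. lborel))"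
  proof -
    have "\<phi> ` {q \<in> W. f q = 0} = {y \<in> open_box n x r. F y = 0}"
      using box F_\<phi> by (force simp: W_def)
    moreover have "\<forall>q\<in>W. f q = 0" if "\<forall>y\<in>open_box n x r. F y = 0"
      using that F_\<phi> by (auto simp: W_def)
    ultimately show ?thesis
      using power_series_zero_set_null[OF \<open>r > 0\<close> series] by metis
  qed
  ultimately show ?thesis
    using that \<open>open W\<close> \<open>p \<in> W\<close> \<open>W \<subseteq> U\<close> by blast
qed

text \<open>The dichotomy holds at every point; connectedness rules out the alternative that
  \<open>f\<close> vanishes near \<open>p\<close>.\<close>

lemma analytic_zero_set_locally_null:
  fixes f :: "'p::{t2_space, second_countable_topology} \<Rightarrow> real"
  assumes atlas: "analytic_atlas n \<A>" and conn: "connected (UNIV :: 'p set)"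
    and f: "analytic_map_on n \<A> UNIV f" and "f p0 \<noteq> 0"
  obtains U \<phi> W where "(U, \<phi>) \<in> \<A>" "open W" "p \<in> W" "W \<subseteq> U" "{q \<in> W. f q = 0} \<in> sets borel"
    "\<phi> ` {q \<in> W. f q = 0} \<in> null_sets (PiM {..<n} (\<lambda>_. lborel))"
proof -
  define I where "I = interior {q. f q = 0}"
  have "I \<subseteq> {q. f q = 0}" "open I"
    by (auto simp: I_def interior_subset)
  have chart: "is_chart n (U, \<phi>)" if "(U, \<phi>) \<in> \<A>" for U \<phi>
    using atlas that unfolding analytic_atlas_def by (elim conjE) (rule bspec)
  have cover: "(\<Union>(U, \<phi>)\<in>\<A>. U) = UNIV"
    using atlas unfolding analytic_atlas_def by (elim conjE)
  have dich: "\<exists>U \<phi> W. (U, \<phi>) \<in> \<A> \<and> open W \<and> p \<in> W \<and> W \<subseteq> U \<and> {q \<in> W. f q = 0} \<in> sets borel \<and>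
      ((\<forall>q\<in>W. f q = 0) \<or> \<phi> ` {q \<in> W. f q = 0} \<in> null_sets (PiM {..<n} (\<lambda>_. lborel)))" for p
  proof -
    obtain U \<phi> where U: "(U, \<phi>) \<in> \<A>" "p \<in> U"
      using UNIV_I[of p, folded cover] by auto
    have "real_analytic_on n (\<phi> ` U) (\<lambda>x. f (inv_into U \<phi> x))"
      using bspec[OF f[unfolded analytic_map_on_def] U(1)] by simp
    from analytic_zero_set_dichotomy[OF chart[OF U(1)] this U(2)] obtain W where
      "open W" "p \<in> W" "W \<subseteq> U" "{q \<in> W. f q = 0} \<in> sets borel"
      "(\<forall>q\<in>W. f q = 0) \<or> \<phi> ` {q \<in> W. f q = 0} \<in> null_sets (PiM {..<n} (\<lambda>_. lborel))" .
    then show ?thesis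
      using U(1) by - (rule exI[of _ U], rule exI[of _ \<phi>], rule exI[of _ W], intro conjI)
  qed
  have "closure I \<subseteq> I"
  proof
    fix p assume "p \<in> closure I"
    obtain U \<phi> W where W: "(U, \<phi>) \<in> \<A>" "open W" "p \<in> W" "W \<subseteq> U" "{q \<in> W. f q = 0} \<in> sets borel"
        "(\<forall>q\<in>W. f q = 0) \<or> \<phi> ` {q \<in> W. f q = 0} \<in> null_sets (PiM {..<n} (\<lambda>_. lborel))"
      using dich[of p] by (elim exE conjE) (rule that)
    \<comment> \<open>Near a limit point of \<open>I\<close>, the zeros in \<open>W\<close> contain
      the nonempty open set \<open>W \<inter> I\<close>. Their image is therefore not null, which
      leaves only vanishing on all of \<open>W\<close>.\<close>
    have ne: "W \<inter> I \<noteq> {}"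
      using open_Int_closure_eq_empty[OF W(2), of I] \<open>p \<in> closure I\<close> W(3) by blast
    have "\<phi> ` (W \<inter> I) \<subseteq> \<phi> ` {q \<in> W. f q = 0}"
      using \<open>I \<subseteq> _\<close> by blast
    then have not_null: "\<phi> ` {q \<in> W. f q = 0} \<notin> null_sets (PiM {..<n} (\<lambda>_. lborel))"
      using is_chart_image_not_subset_null[OF chart[OF W(1)] open_Int[OF W(2) \<open>open I\<close>]
          le_infI1[OF W(4)] ne] by metis
    have "\<forall>q\<in>W. f q = 0"
      by (rule disjE[OF W(6)], assumption) (erule notE[OF not_null])
    then show "p \<in> I"
      using W(2,3) unfolding I_def by (intro interiorI[of W]) auto
  qed
  then have "closed I"
    by (metis closed_closure closure_subset subset_antisym)
  then have "I = {} \<or> I = UNIV"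
    using conn \<open>open I\<close> connected_clopen[of "UNIV :: 'p set"] by auto
  then have "I = {}"
    using \<open>f p0 \<noteq> 0\<close> \<open>I \<subseteq> _\<close> by auto
  obtain U \<phi> W where W: "(U, \<phi>) \<in> \<A>" "open W" "p \<in> W" "W \<subseteq> U" "{q \<in> W. f q = 0} \<in> sets borel"
      "(\<forall>q\<in>W. f q = 0) \<or> \<phi> ` {q \<in> W. f q = 0} \<in> null_sets (PiM {..<n} (\<lambda>_. lborel))"
    using dich[of p] by (elim exE conjE) (rule that)
  have nonzero: "\<not> (\<forall>q\<in>W. f q = 0)"
  proof
    assume "\<forall>q\<in>W. f q = 0"
    then have "p \<in> I"
      using W(2,3) unfolding I_def by (intro interiorI[of W]) auto
    then show False
      using \<open>I = {}\<close> by simp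
  qed
  have "\<phi> ` {q \<in> W. f q = 0} \<in> null_sets (PiM {..<n} (\<lambda>_. lborel))"
    by (rule disjE[OF W(6)]) (erule notE[OF nonzero], assumption)
  with W(1-5) show ?thesis
    by (rule that)
qed

lemma analytic_zero_set_null:
  fixes f :: "'p::{t2_space, second_countable_topology} \<Rightarrow> real"
  assumes atlas: "analytic_atlas n \<A>" and conn: "connected (UNIV :: 'p set)"
    and f: "analytic_map_on n \<A> UNIV f" "f p0 \<noteq> 0"
    and \<mu>: "smooth_volume_measure n \<A> \<mu>"
  shows "{p. f p = 0} \<in> null_sets \<mu>"
proof -
  \<comment> \<open>These open sets cover the manifold; by second countability, countably many of
    them suffice.\<close>
  define \<W> where "\<W> = {W. open W \<and> {q \<in> W. f q = 0} \<in> null_sets \<mu>}"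
  have "\<exists>W\<in>\<W>. p \<in> W" for p
  proof -
    obtain U \<phi> W where W: "(U, \<phi>) \<in> \<A>" "open W" "p \<in> W" "W \<subseteq> U"
      and borel: "{q \<in> W. f q = 0} \<in> sets borel"
      and null: "\<phi> ` {q \<in> W. f q = 0} \<in> null_sets (PiM {..<n} (\<lambda>_. lborel))"
      by (rule analytic_zero_set_locally_null[OF atlas conn f])
    obtain \<rho> :: "(nat \<Rightarrow> real) \<Rightarrow> real" where
      \<rho>: "\<And>B. B \<in> sets borel \<Longrightarrow> B \<subseteq> U \<Longrightarrow> emeasure \<mu> B =
        (\<integral>\<^sup>+x. ennreal (\<rho> x) * indicator (\<phi> ` B) x \<partial>PiM {..<n} (\<lambda>_. lborel))"
      using bspec[OF conjunct2[OF \<mu>[unfolded smooth_volume_measure_def]] W(1), unfolded prod.case]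
      by (elim exE conjE) (rule that, simp)
    have "emeasure \<mu> {q \<in> W. f q = 0} = (\<integral>\<^sup>+x. ennreal (\<rho> x) *
        indicator (\<phi> ` {q \<in> W. f q = 0}) x \<partial>PiM {..<n} (\<lambda>_. lborel))"
      using W(4) borel by (intro \<rho>) auto
    \<comment> \<open>The integrand vanishes off the null image of the zeros, whatever the
      density.\<close>
    also have "\<dots> = (\<integral>\<^sup>+x. 0 \<partial>PiM {..<n} (\<lambda>_. lborel :: real measure))"
      using AE_not_in[OF null] by (intro nn_integral_cong_AE) (auto elim!: eventually_mono)
    finally have "{q \<in> W. f q = 0} \<in> null_sets \<mu>"
      using borel \<mu> by (simp add: null_sets_def smooth_volume_measure_def)
    then show ?thesis
      using W(2,3) by (auto simp: \<W>_def)
  qed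
  then have cover: "\<Union>\<W> = UNIV"
    by blast
  have "open W" if "W \<in> \<W>" for W
    using that by (simp add: \<W>_def)
  from Lindelof[OF this] obtain \<W>' where
    "\<W>' \<subseteq> \<W>" "countable \<W>'" "\<Union>\<W>' = \<Union>\<W>" .
  have "{p. f p = 0} = {p \<in> \<Union>\<W>'. f p = 0}"
    by (simp add: \<open>\<Union>\<W>' = \<Union>\<W>\<close> cover)
  also have "\<dots> = (\<Union>W\<in>\<W>'. {q \<in> W. f q = 0})"
    by auto
  also have "\<dots> \<in> null_sets \<mu>"
    using \<open>\<W>' \<subseteq> \<W>\<close> by (intro null_sets_UN' \<open>countable \<W>'\<close>) (auto simp: \<W>_def)
  finally show ?thesis .
qed

theorem theorem8:
  fixes n :: nat
    and \<A> :: "'p::{t2_space, second_countable_topology} chart set"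
    and \<Xi> :: "'p \<Rightarrow> 'g::finite block_data"
    and S :: "'p set"
  assumes "CARD('g) \<ge> 2"
    and "analytic_atlas n \<A>"
    and "connected (UNIV :: 'p set)"
    and "analytic_map_on n \<A> UNIV \<Xi>"
    and "\<And>p. gram_block_data (\<Xi> p)"
    and "\<And>p. p \<in> S \<Longrightarrow> rank_one_conditions (\<Xi> p)"
    and "\<exists>h \<in> minor_functions. \<not> (\<forall>p. h (\<Xi> p) = 0)"
  shows "(\<exists>Z. analytic_subset n \<A> Z \<and> Z \<noteq> UNIV \<and> S \<subseteq> Z) \<and>
         (\<forall>\<mu>. smooth_volume_measure n \<A> \<mu> \<longrightarrow> S \<in> null_sets (completion \<mu>))"
proof -
  obtain h p0 where h: "h \<in> minor_functions" "h (\<Xi> p0) \<noteq> 0"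
    using assms(7) by blast
  define f where "f p = h (\<Xi> p)" for p
  have f: "analytic_map_on n \<A> UNIV f"
    using assms(4) h(1)
    by (auto simp: analytic_map_on_def f_def intro: real_analytic_on_minor_functions)
  have "f p0 \<noteq> 0"
    using h(2) by (simp add: f_def)
  have S: "S \<subseteq> {p. f p = 0}"
    using minor_functions_eq_0_if_rank_one_conditions[OF h(1) assms(6)] by (auto simp: f_def)
  have "analytic_subset n \<A> {p. f p = 0}"
    \<comment> \<open>The single global equation \<open>f = 0\<close> serves at every point, with
      the whole manifold as neighbourhood.\<close>
    unfolding analytic_subset_def using f by (intro allI exI[of _ UNIV] exI[of _ "{f}"]) auto
  moreover have "{p. f p = 0} \<noteq> UNIV"
    using \<open>f p0 \<noteq> 0\<close> by auto
  \<comment> \<open>\<open>S\<close> may fail to be Borel; as a subset of a null set it is null for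
    the completed measure.\<close>
  moreover have "S \<in> null_sets (completion \<mu>)" if "smooth_volume_measure n \<A> \<mu>" for \<mu>
    using null_sets_completionI[OF analytic_zero_set_null[OF assms(2,3) f \<open>f p0 \<noteq> 0\<close> that]] S
    by (rule null_sets_completion_subset[rotated])
  ultimately show ?thesis
    using S by blast
qed

end
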